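(* Let $\gamma>0$, $\Omega=[0,1]$, and let $(\chi,v)$ be a global smooth solution of the one-dimensional damped pressureless Euler system in Lagrangian form $$\partial_t\chi_t(\eta)=v_t(\eta),\qquad \partial_tv_t(\eta)=-(\partial_xV)(\chi_t(\eta))-\int_\Omega(\partial_xW)(\chi_t(\eta)-\chi_t(\bar\eta))\,d\bar\eta-\gamma v_t(\eta),\qquad \eta\in\Omega,\ t>0,$$ with potentials $V(x)=|x|^2/2$ and $W(x)=-|x|$. Let $\chi_\infty(\eta)=2\eta-1$ and suppose that the initial data satisfies $\|\chi_0-\chi_\infty\|_{L^2(\Omega)}+\|v_0\|_{L^2(\Omega)}<\infty$. Then $$\lim_{t\to\infty}\Big(\|\chi_t-\chi_\infty\|_{L^2(\Omega)}+\|v_t\|_{L^2(\Omega)}\Big)=0$$ exponentially fast. In particular, $$\lim_{t\to\infty}W_2(\mu_t,\mu_\infty)=0$$ exponentially fast, where $\mu_t=\chi_t\#(\mathbf{1}_\Omega\,d\eta)$ and $\mu_\infty=\chi_\infty\#(\mathbf{1}_\Omega\,d\eta)=\tfrac12\mathbf{1}_{(-1,1)}\,dx$.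
   Context: $W_2$ is the 2-Wasserstein distance on probability measures on $\mathbb{R}$ with finite second moment; $\chi\#m$ denotes push-forward. $\chi_t$ is the pseudo-inverse of the cumulative distribution function $F_t(x)=\mu_t((-\infty,x])$, i.e. $\chi_t(\eta)=\inf\{x\in\mathbb{R}: F_t(x)>\eta\}$, and $v_t$ is the Lagrangian velocity. A smooth solution is one for which $\chi_t$ is strictly monotonically increasing (up to sets of zero measure) for all times; for such solutions the system takes the form $\partial_t\chi_t=v_t$, $\partial_tv_t=-(\chi_t-\chi_\infty)-\gamma v_t$. "Exponentially fast" means bounded by $Ce^{-\lambda t}$ for all $t\ge0$ for some constants $C,\lambda>0$. *)

theory Defs
  imports "HOL-Probability.Probability"
begin

section \<open>The Lagrangian reference space\<close>

abbreviation \<Omega> :: "real measure" where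
  "\<Omega> \<equiv> lebesgue_on {0..1}"

definition ennsqrt :: "ennreal \<Rightarrow> ennreal" where
  "ennsqrt x = (if x = \<infinity> then \<infinity> else ennreal (sqrt (enn2real x)))"

text \<open>Extended-valued, so that \<open>L2_norm f < \<infinity>\<close> says, for a measurable \<open>f\<close>,
  that \<open>f\<close> is square integrable.\<close>

definition L2_norm :: "(real \<Rightarrow> real) \<Rightarrow> ennreal" where
  "L2_norm f = ennsqrt (\<integral>\<^sup>+\<eta>. ennreal ((f \<eta>)\<^sup>2) \<partial>\<Omega>)"

definition push :: "(real \<Rightarrow> real) \<Rightarrow> real measure" where
  "push f = distr \<Omega> borel f"


section \<open>The quadratic Wasserstein distance\<close>

definition P2 :: "real measure set" where
  "P2 = {\<mu>. prob_space \<mu> \<and> sets \<mu> = sets borel \<and> (\<integral>\<^sup>+x. ennreal (x\<^sup>2) \<partial>\<mu>) < \<infinity>}"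

definition couplings :: "real measure \<Rightarrow> real measure \<Rightarrow> (real \<times> real) measure set" where
  "couplings \<mu> \<nu> = {\<pi>. sets \<pi> = sets (borel \<Otimes>\<^sub>M borel) \<and>
                      distr \<pi> borel fst = \<mu> \<and> distr \<pi> borel snd = \<nu>}"

definition W2 :: "real measure \<Rightarrow> real measure \<Rightarrow> ennreal" where
  "W2 \<mu> \<nu> = ennsqrt (INF \<pi>\<in>couplings \<mu> \<nu>. \<integral>\<^sup>+(x, y). ennreal ((x - y)\<^sup>2) \<partial>\<pi>)"


section \<open>The damped pressureless Euler system in Lagrangian form\<close>

text \<open>The derivative of a potential, with value \<open>0\<close> at points of non-differentiability.
  For \<open>W x = - \<bar>x\<bar>\<close> this gives \<open>- sgn x\<close>. The value at the kink enters
  the system only through the set of \<open>\<eta>'\<close> with \<open>X t \<eta>' = X t \<eta>\<close>, which for almost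
  every \<open>\<eta>\<close> is a null set if \<open>X t\<close> is strictly increasing up to null sets.\<close>

definition pot_deriv :: "(real \<Rightarrow> real) \<Rightarrow> real \<Rightarrow> real" where
  "pot_deriv U x = (if U field_differentiable (at x) then deriv U x else 0)"

text \<open>For a distribution function \<open>F\<close> and \<open>0 < \<eta> < 1\<close> the set is nonempty and bounded below.
  At \<open>\<eta> = 0\<close> and \<open>\<eta> = 1\<close> it need not be, and the real infimum is then meaningless.\<close>

definition pseudo_inverse :: "(real \<Rightarrow> real) \<Rightarrow> real \<Rightarrow> real" where
  "pseudo_inverse F \<eta> = Inf {x. F x > \<eta>}"

text \<open>\<open>X t \<eta>\<close> stands for \<open>\<chi>\<^sub>t(\<eta>)\<close>. The first argument of \<open>X\<close> and \<open>v\<close> is time, the second one the label in \<open>{0..1}\<close>.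
  The maps are understood up to null sets of labels; the equations hold pointwise in time, for
  almost every label. Continuity up to time \<open>0\<close> means that the initial data are attained.\<close>

definition euler_lagrangian_solution ::
  "(real \<Rightarrow> real) \<Rightarrow> (real \<Rightarrow> real) \<Rightarrow> real \<Rightarrow>
   (real \<Rightarrow> real \<Rightarrow> real) \<Rightarrow> (real \<Rightarrow> real \<Rightarrow> real) \<Rightarrow> bool" where
  "euler_lagrangian_solution V W \<gamma> X v \<longleftrightarrow>
     (\<forall>t\<ge>0. X t \<in> borel_measurable \<Omega> \<and> v t \<in> borel_measurable \<Omega>) \<and>
     (\<forall>t\<ge>0. AE \<eta> in \<Omega>. X t \<eta> = pseudo_inverse (cdf (push (X t))) \<eta>) \<and>
     (AE \<eta> in \<Omega>.
        continuous_on {0..} (\<lambda>t. X t \<eta>) \<and> continuous_on {0..} (\<lambda>t. v t \<eta>) \<and>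
        (\<forall>t>0. ((\<lambda>s. X s \<eta>) has_real_derivative v t \<eta>) (at t) \<and>
               ((\<lambda>s. v s \<eta>) has_real_derivative
                  (- pot_deriv V (X t \<eta>)
                   - (LINT \<eta>'|\<Omega>. pot_deriv W (X t \<eta> - X t \<eta>'))
                   - \<gamma> * v t \<eta>)) (at t)))"

definition smooth_solution :: "(real \<Rightarrow> real \<Rightarrow> real) \<Rightarrow> bool" where
  "smooth_solution X \<longleftrightarrow> (\<forall>t\<ge>0. \<exists>N\<in>null_sets \<Omega>. strict_mono_on ({0..1} - N) (X t))"

definition chi_inf :: "real \<Rightarrow> real" where
  "chi_inf \<eta> = 2 * \<eta> - 1"

definition exponentially_fast :: "(real \<Rightarrow> ennreal) \<Rightarrow> bool" where
  "exponentially_fast f \<longleftrightarrow>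
     (\<exists>C lam :: real. C > 0 \<and> lam > 0 \<and> (\<forall>t\<ge>0. f t \<le> ennreal (C * exp (- lam * t))))"

end

theory Submission
  imports Defs
begin

text \<open>If \<open>X t\<close> is strictly increasing, the interaction force at label \<open>\<eta>\<close> equals
  \<open>\<integral> sgn (\<eta> - \<eta>') d\<eta>' = 2 * \<eta> - 1 = chi_inf \<eta>\<close>, so that almost every label obeys the damped
  oscillator \<open>u'' = - u - \<gamma> u'\<close> for \<open>u = X t \<eta> - chi_inf \<eta>\<close>. For a suitable \<open>a\<close>, the function
  \<open>u\<^sup>2 + (u')\<^sup>2 + a u u'\<close> decays exponentially at a rate independent of the label, and the estimate is
  integrated over the labels. The Wasserstein distance is bounded through the coupling
  \<open>(X t, chi_inf)\<close>.

  The null set on which \<open>X t\<close> fails to increase strictly may depend on \<open>t\<close>, whereas the oscillator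
  equation is needed at all times for a fixed label. Continuity in time makes \<open>X t\<close> nondecreasing
  off a single null set, by way of rational times; strictness off the same set follows since a
  nondecreasing function that is not strictly increasing there is constant on a set of positive
  measure.\<close>

subsection \<open>Square roots and exponential decay in the extended reals\<close>

lemma ennsqrt_mono:
  assumes "x \<le> y"
  shows "ennsqrt x \<le> ennsqrt y"
proof (cases "y = \<infinity>")
  case False
  then have "y < top"
    by (simp add: less_top)
  then have "x < top" "enn2real x \<le> enn2real y"
    using assms by (auto intro: enn2real_mono)
  then show ?thesis
    using False by (auto simp: ennsqrt_def intro!: ennreal_leI)
qed (simp add: ennsqrt_def)

lemma ennsqrt_ennreal_power2: "r \<ge> 0 \<Longrightarrow> ennsqrt (ennreal (r\<^sup>2)) = ennreal r"
  by (simp add: ennsqrt_def)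

lemma ennsqrt_less_top_iff: "ennsqrt x < top \<longleftrightarrow> x < top"
  by (auto simp: ennsqrt_def less_top)

lemma exponentially_fast_mono:
  assumes "exponentially_fast g" "\<And>t. t \<ge> 0 \<Longrightarrow> f t \<le> g t"
  shows "exponentially_fast f"
  using assms unfolding exponentially_fast_def by (meson order_trans)

lemma exponentially_fast_imp_tendsto_0:
  assumes "exponentially_fast f"
  shows "(f \<longlongrightarrow> 0) at_top"
proof -
  obtain C lam where C: "C > 0" "lam > 0" "\<And>t. t \<ge> 0 \<Longrightarrow> f t \<le> ennreal (C * exp (- lam * t))"
    using assms unfolding exponentially_fast_def by blast
  have "((\<lambda>t. C * exp (- lam * t)) \<longlongrightarrow> 0) at_top"
    using C(2) by (intro tendsto_mult_right_zero filterlim_compose[OF exp_at_bot]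
      filterlim_tendsto_neg_mult_at_bot[OF tendsto_const _ filterlim_ident]) auto
  then have "((\<lambda>t. ennreal (C * exp (- lam * t))) \<longlongrightarrow> ennreal 0) at_top"
    by (rule tendsto_ennrealI)
  then have lim: "((\<lambda>t. ennreal (C * exp (- lam * t))) \<longlongrightarrow> 0) at_top"
    by simp
  have "\<forall>\<^sub>F t in at_top. f t \<le> ennreal (C * exp (- lam * t))"
    using eventually_ge_at_top[of "0::real"] by eventually_elim (rule C(3))
  then show ?thesis
    by (rule tendsto_sandwich[OF _ _ tendsto_const lim, rotated]) simp
qed

subsection \<open>The potentials\<close>

lemma pot_deriv_quadratic: "pot_deriv (\<lambda>x. \<bar>x\<bar>\<^sup>2 / 2) x = x"
proof -
  have "((\<lambda>x::real. \<bar>x\<bar>\<^sup>2 / 2) has_field_derivative x) (at x)"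
    unfolding power2_abs by (auto intro!: derivative_eq_intros)
  then show ?thesis
    unfolding pot_deriv_def field_differentiable_def by (auto intro: DERIV_imp_deriv)
qed

text \<open>The difference quotient at the kink tends to -1 from the right and to 1 from the
  left.\<close>

lemma not_DERIV_neg_abs_0: "\<not> ((\<lambda>x::real. - \<bar>x\<bar>) has_real_derivative D) (at 0)"
proof
  assume "((\<lambda>x::real. - \<bar>x\<bar>) has_real_derivative D) (at 0)"
  then have D: "(\<lambda>h. (- \<bar>h\<bar>) / h) \<midarrow>0\<rightarrow> D"
    unfolding DERIV_def by simp
  have "((\<lambda>h. (- \<bar>h\<bar>) / h) \<longlongrightarrow> D) (at_right 0)" "((\<lambda>h. (- \<bar>h\<bar>) / h) \<longlongrightarrow> D) (at_left 0)"
    using D by (auto simp: filterlim_at_split)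
  moreover have "((\<lambda>h::real. (- \<bar>h\<bar>) / h) \<longlongrightarrow> -1) (at_right 0)"
    by (rule tendsto_eventually) (auto simp: eventually_at intro!: exI[of _ 1])
  moreover have "((\<lambda>h::real. (- \<bar>h\<bar>) / h) \<longlongrightarrow> 1) (at_left 0)"
    by (rule tendsto_eventually) (auto simp: eventually_at intro!: exI[of _ 1])
  ultimately have "D = -1" "D = 1"
    by (auto intro: tendsto_unique[rotated])
  then show False
    by simp
qed

text \<open>Away from the kink the potential agrees locally with a linear function. At the kink the
  default value 0 of \<open>pot_deriv\<close> equals \<open>- sgn 0\<close>, so the formula has no
  exceptional point.\<close>

lemma pot_deriv_neg_abs: "pot_deriv (\<lambda>x. - \<bar>x\<bar>) x = - sgn x"
proof (cases "x = 0")
  case True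
  then show ?thesis
    using not_DERIV_neg_abs_0 by (auto simp: pot_deriv_def field_differentiable_def)
next
  case False
  have "((\<lambda>y. - sgn x * y) has_field_derivative - sgn x) (at x)"
    by (auto intro!: derivative_eq_intros)
  then have "((\<lambda>x::real. - \<bar>x\<bar>) has_field_derivative - sgn x) (at x)"
    by (rule has_field_derivative_transform_within_open[where S = "if x > 0 then {0<..} else {..<0}"])
       (use False in \<open>auto split: if_splits\<close>)
  then show ?thesis
    unfolding pot_deriv_def field_differentiable_def by (auto intro: DERIV_imp_deriv)
qed

subsection \<open>The reference space\<close>

lemma prob_space_Omega: "prob_space \<Omega>"
  by (rule prob_spaceI) (simp add: emeasure_restrict_space)

lemma ident_measurable_Omega: "(\<lambda>\<eta>. \<eta>) \<in> borel_measurable \<Omega>"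
  by (rule measurable_restrict_space1) (auto simp: measurable_completion)

lemma borel_measurable_Omega: "f \<in> borel_measurable borel \<Longrightarrow> f \<in> borel_measurable \<Omega>"
  by (rule measurable_restrict_space1) (auto simp: measurable_completion)

lemma chi_inf_measurable: "chi_inf \<in> borel_measurable borel"
  unfolding chi_inf_def by measurable

text \<open>The interval has measure \<open>b - a > 0\<close>, so it cannot lie inside a null set.
  This supplies good labels between two given ones.\<close>

lemma AE_Omega_ex_in_interval:
  assumes "AE \<eta> in \<Omega>. P \<eta>" "0 \<le> a" "a < b" "b \<le> 1"
  obtains p where "a < p" "p < b" "P p"
proof -
  have "\<exists>p\<in>{a<..<b}. P p"
  proof (rule ccontr)
    assume "\<not> (\<exists>p\<in>{a<..<b}. P p)"
    with assms(1) have "AE \<eta> in \<Omega>. \<eta> \<notin> {a<..<b}"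
      by (auto elim!: AE_mp)
    moreover have "{a<..<b} \<in> sets \<Omega>"
      using assms by (auto simp: sets_restrict_space_iff)
    ultimately have "emeasure \<Omega> {a<..<b} = 0"
      by (simp add: AE_iff_null_sets null_setsD1)
    moreover have "emeasure \<Omega> {a<..<b} = ennreal (b - a)"
      using assms by (subst emeasure_restrict_space) auto
    ultimately show False
      using assms by simp
  qed
  then show thesis
    using that by auto
qed

text \<open>The labels below \<open>\<eta>\<close> contribute their measure \<open>\<eta>\<close>,
  those above contribute \<open>- (1 - \<eta>)\<close>. This is where the equilibrium
  \<open>chi_inf\<close> comes from.\<close>

lemma LINT_sgn_diff:
  assumes "\<eta> \<in> {0..1}"
  shows "(LINT \<eta>'|\<Omega>. sgn (\<eta> - \<eta>')) = chi_inf \<eta>"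
proof -
  interpret prob_space \<Omega>
    by (rule prob_space_Omega)
  have sets: "{0..<\<eta>} \<in> sets \<Omega>" "{\<eta><..1} \<in> sets \<Omega>"
    using assms by (auto simp: sets_restrict_space_iff)
  have int: "integrable \<Omega> (indicator {0..<\<eta>} :: real \<Rightarrow> real)" "integrable \<Omega> (indicator {\<eta><..1} :: real \<Rightarrow> real)"
    using sets by (auto simp: less_top[symmetric])
  have "(LINT \<eta>'|\<Omega>. sgn (\<eta> - \<eta>'))
      = (LINT \<eta>'|\<Omega>. indicator {0..<\<eta>} \<eta>' - indicator {\<eta><..1} \<eta>')"
    by (rule Bochner_Integration.integral_cong) (auto simp: indicator_def)
  also have "\<dots> = measure \<Omega> ({0..<\<eta>} \<inter> space \<Omega>) - measure \<Omega> ({\<eta><..1} \<inter> space \<Omega>)"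
    by (simp only: Bochner_Integration.integral_diff[OF int] Bochner_Integration.integral_indicator)
  also have "\<dots> = measure \<Omega> {0..<\<eta>} - measure \<Omega> {\<eta><..1}"
    using sets by (simp only: sets.Int_space_eq2)
  also have "\<dots> = \<eta> - (1 - \<eta>)"
    using assms by (subst (1 2) measure_restrict_space) auto
  finally show ?thesis
    by (simp add: chi_inf_def)
qed

text \<open>A strictly increasing map preserves the sign of differences, and the labels outside
  \<open>G\<close> do not affect the integral. The value is therefore the same for all such
  maps.\<close>

lemma LINT_sgn_strict_mono:
  assumes X: "X \<in> borel_measurable \<Omega>" and G: "AE \<eta> in \<Omega>. \<eta> \<in> G"
    and mono: "strict_mono_on G X" and \<eta>: "\<eta> \<in> G" "\<eta> \<in> {0..1}"
  shows "(LINT \<eta>'|\<Omega>. sgn (X \<eta> - X \<eta>')) = chi_inf \<eta>"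
proof -
  have [measurable]: "X \<in> borel_measurable \<Omega>" "(\<lambda>\<eta>. \<eta>) \<in> borel_measurable \<Omega>"
    using X ident_measurable_Omega by auto
  have "(LINT \<eta>'|\<Omega>. sgn (X \<eta> - X \<eta>')) = (LINT \<eta>'|\<Omega>. sgn (\<eta> - \<eta>'))"
  proof (rule integral_cong_AE)
    show "AE \<eta>' in \<Omega>. sgn (X \<eta> - X \<eta>') = sgn (\<eta> - \<eta>')"
      using G
    proof (rule AE_mp, intro AE_I2 impI)
      fix \<eta>' assume "\<eta>' \<in> G"
      then show "sgn (X \<eta> - X \<eta>') = sgn (\<eta> - \<eta>')"
        using strict_mono_onD[OF mono, of \<eta> \<eta>'] strict_mono_onD[OF mono, of \<eta>' \<eta>] \<eta>
        by (cases \<eta> \<eta>' rule: linorder_cases) auto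
    qed
  qed measurable
  then show ?thesis
    using LINT_sgn_diff[OF \<eta>(2)] by simp
qed

subsection \<open>The damped oscillator\<close>

text \<open>Friction alone dissipates \<open>2 * \<gamma> * v\<^sup>2\<close>, which does not
  control \<open>u\<close>; the cross term \<open>a * u * v\<close> adds the missing
  \<open>- a * u\<^sup>2\<close>. The value of \<open>a\<close> is small enough for friction to
  absorb the other terms that it produces, and \<open>a \<le> 1\<close> keeps the modified energy
  comparable to \<open>u\<^sup>2 + v\<^sup>2\<close>.\<close>

lemma damped_oscillator_decay:
  fixes u v :: "real \<Rightarrow> real"
  assumes "\<gamma> > 0" and a: "a = \<gamma> / (1 + \<gamma>\<^sup>2)"
    and cont: "continuous_on {0..} u" "continuous_on {0..} v"
    and du: "\<And>t. t > 0 \<Longrightarrow> (u has_real_derivative v t) (at t)"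
    and dv: "\<And>t. t > 0 \<Longrightarrow> (v has_real_derivative - u t - \<gamma> * v t) (at t)"
    and "t \<ge> 0"
  shows "(u t)\<^sup>2 + (v t)\<^sup>2 \<le> 4 * exp (- (a / 4) * t) * ((u 0)\<^sup>2 + (v 0)\<^sup>2)"
proof -
  have pos: "1 + \<gamma>\<^sup>2 > 0"
    by (simp add: add_pos_nonneg)
  have a0: "a > 0" and a\<gamma>: "a * (1 + \<gamma>\<^sup>2) = \<gamma>"
    using assms(1) pos by (auto simp: a)
  have a1: "a \<le> 1"
  proof -
    have "0 \<le> (\<gamma> - 1)\<^sup>2"
      by simp
    then have "\<gamma> \<le> 1 + \<gamma>\<^sup>2"
      using assms(1) unfolding power2_eq_square by (simp add: algebra_simps)
    then show ?thesis
      using pos by (simp add: a)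
  qed
  define E where "E s = (u s)\<^sup>2 + (v s)\<^sup>2 + a * (u s * v s)" for s
  have cross: "\<bar>a * (u s * v s)\<bar> \<le> ((u s)\<^sup>2 + (v s)\<^sup>2) / 2" for s
  proof -
    have "\<bar>a * (u s * v s)\<bar> \<le> 1 * \<bar>u s * v s\<bar>"
      unfolding abs_mult using a0 a1 by (intro mult_right_mono) auto
    also have "\<dots> \<le> ((u s)\<^sup>2 + (v s)\<^sup>2) / 2"
      using sum_squares_bound[of "\<bar>u s\<bar>" "\<bar>v s\<bar>"] by (simp add: abs_mult)
    finally show ?thesis .
  qed
  \<comment> \<open>The ratio of the two constants, 2 and 1/2, is the factor 4 of the
    conclusion.\<close>
  have E_bounds: "((u s)\<^sup>2 + (v s)\<^sup>2) / 2 \<le> E s" "E s \<le> 2 * ((u s)\<^sup>2 + (v s)\<^sup>2)" for s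
    using cross[of s] zero_le_power2[of "u s"] zero_le_power2[of "v s"]
    unfolding E_def abs_le_iff by (auto simp: field_simps)
  define E' where "E' s = 2 * u s * v s + 2 * v s * (- u s - \<gamma> * v s)
      + a * (v s * v s + u s * (- u s - \<gamma> * v s))" for s
  have dE: "(E has_real_derivative E' s) (at s)" if "s > 0" for s
    unfolding E_def E'_def
    by (rule derivative_eq_intros du[OF that] dv[OF that] refl)+ (simp add: algebra_simps)
  have E'_le: "E' s \<le> - (a / 4) * E s" for s
  proof -
    \<comment> \<open>This square bounds the mixed term \<open>- a * \<gamma> * u s * v s\<close> at
      the price of half of \<open>a * (u s)\<^sup>2\<close> and a multiple of
      \<open>(v s)\<^sup>2\<close>. The relation
      \<open>a * (1 + \<gamma>\<^sup>2) = \<gamma>\<close> then lets the friction term pay for all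
      the terms in \<open>(v s)\<^sup>2\<close>.\<close>
    have "0 \<le> a / 2 * (u s + \<gamma> * v s)\<^sup>2"
      using a0 by simp
    moreover have "a * (v s)\<^sup>2 + a * \<gamma>\<^sup>2 * (v s)\<^sup>2 = \<gamma> * (v s)\<^sup>2"
      using arg_cong[OF a\<gamma>, of "\<lambda>c. c * (v s)\<^sup>2"] by (simp add: algebra_simps)
    moreover have "a * \<gamma>\<^sup>2 * (v s)\<^sup>2 \<ge> 0" "a * (u s)\<^sup>2 \<ge> 0" "a * (v s)\<^sup>2 \<ge> 0"
      using a0 by auto
    moreover have "E' s = - 2 * (\<gamma> * (v s)\<^sup>2) + a * (v s)\<^sup>2 - a * (u s)\<^sup>2 - a * \<gamma> * u s * v s"
      unfolding E'_def power2_eq_square by (simp add: algebra_simps)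
    moreover have "a / 2 * (u s + \<gamma> * v s)\<^sup>2
        = a * (u s)\<^sup>2 / 2 + a * \<gamma> * u s * v s + a * \<gamma>\<^sup>2 * (v s)\<^sup>2 / 2"
      unfolding power2_eq_square by (simp add: field_simps)
    ultimately have "E' s \<le> - (a * (u s)\<^sup>2) / 2 - a * (v s)\<^sup>2 / 2"
      by linarith
    also have "\<dots> = - (a / 4) * (2 * ((u s)\<^sup>2 + (v s)\<^sup>2))"
      by (simp add: field_simps)
    also have "\<dots> \<le> - (a / 4) * E s"
      using a0 E_bounds(2)[of s] by (intro mult_left_mono_neg) auto
    finally show ?thesis .
  qed
  \<comment> \<open>The integrating factor turns the differential inequality for \<open>E\<close>
    into monotonicity of \<open>F\<close>.\<close>
  define F where "F s = exp (a / 4 * s) * E s" for s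
  \<comment> \<open>The equations are given for positive times only; time 0 is reached by
    continuity.\<close>
  have "F t \<le> F 0"
  proof (rule DERIV_nonpos_imp_decreasing_open[of 0 t F])
    show "0 \<le> t"
      using \<open>t \<ge> 0\<close> .
    fix s assume "0 < s" "s < t"
    have "(F has_real_derivative exp (a / 4 * s) * (a / 4 * E s + E' s)) (at s)"
      unfolding F_def
      by (rule derivative_eq_intros dE[OF \<open>0 < s\<close>] refl)+ (simp add: algebra_simps)
    moreover have "exp (a / 4 * s) * (a / 4 * E s + E' s) \<le> 0"
      using E'_le[of s] by (intro mult_nonneg_nonpos) auto
    ultimately show "\<exists>y. (F has_real_derivative y) (at s) \<and> y \<le> 0"
      by blast
  next
    show "continuous_on {0..t} F"
      unfolding F_def E_def
      by (intro continuous_intros continuous_on_subset[OF cont(1)] continuous_on_subset[OF cont(2)]) auto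
  qed
  have "E t = exp (- (a / 4) * t) * F t"
    by (simp add: F_def exp_minus)
  also have "\<dots> \<le> exp (- (a / 4) * t) * (2 * ((u 0)\<^sup>2 + (v 0)\<^sup>2))"
    using \<open>F t \<le> F 0\<close> E_bounds(2)[of 0] by (intro mult_left_mono) (auto simp: F_def)
  finally have "2 * E t \<le> 4 * exp (- (a / 4) * t) * ((u 0)\<^sup>2 + (v 0)\<^sup>2)"
    by (simp add: algebra_simps)
  with E_bounds(1)[of t] show ?thesis
    by simp
qed

subsection \<open>Smooth solutions\<close>

lemma smooth_solution_uniform:
  assumes smooth: "smooth_solution X"
    and cont: "AE \<eta> in \<Omega>. continuous_on {0..} (\<lambda>t. X t \<eta>)"
  obtains G where "G \<subseteq> {0..1}" "AE \<eta> in \<Omega>. \<eta> \<in> G" "\<And>t. t \<ge> 0 \<Longrightarrow> strict_mono_on G (X t)"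
proof -
  have "\<forall>t. \<exists>N. t \<ge> 0 \<longrightarrow> N \<in> null_sets \<Omega> \<and> strict_mono_on ({0..1} - N) (X t)"
    using smooth unfolding smooth_solution_def by blast
  then obtain N where N: "\<And>t. t \<ge> 0 \<Longrightarrow> N t \<in> null_sets \<Omega>"
      "\<And>t. t \<ge> 0 \<Longrightarrow> strict_mono_on ({0..1} - N t) (X t)"
    by metis
  \<comment> \<open>The union of the exceptional sets over all times need not be null, so only the
    countably many at rational times are discarded.\<close>
  define G where "G = {\<eta>\<in>{0..1}. continuous_on {0..} (\<lambda>t. X t \<eta>) \<and> (\<forall>q\<in>\<rat> \<inter> {0..}. \<eta> \<notin> N q)}"
  have "AE \<eta> in \<Omega>. \<forall>q\<in>\<rat> \<inter> {0..}. \<eta> \<notin> N q"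
    by (subst AE_ball_countable) (auto intro: AE_not_in N simp: countable_rat)
  moreover have "AE \<eta> in \<Omega>. \<eta> \<in> {0..1}"
    using AE_space[of \<Omega>] by simp
  ultimately have AE_G: "AE \<eta> in \<Omega>. \<eta> \<in> G"
    using cont unfolding G_def by eventually_elim auto
  have mono: "X t \<eta> \<le> X t \<eta>'" if "t \<ge> 0" "\<eta> \<in> G" "\<eta>' \<in> G" "\<eta> < \<eta>'" for t \<eta> \<eta>'
  proof (rule ccontr)
    assume "\<not> X t \<eta> \<le> X t \<eta>'"
    then have neg: "X t \<eta> - X t \<eta>' > 0"
      by simp
    have "continuous_on {0..} (\<lambda>s. X s \<eta> - X s \<eta>')"
      using that by (auto simp: G_def intro!: continuous_intros)
    then have "((\<lambda>s. X s \<eta> - X s \<eta>') \<longlongrightarrow> X t \<eta> - X t \<eta>') (at t within {0..})"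
      using that(1) by (auto simp: continuous_on_def)
    then have "\<forall>\<^sub>F s in at t within {0..}. X s \<eta> - X s \<eta>' > 0"
      using neg by (rule order_tendstoD(1))
    then obtain d where d: "d > 0" "\<And>s. s \<in> {0..} \<Longrightarrow> s \<noteq> t \<Longrightarrow> dist s t < d \<Longrightarrow> X s \<eta> - X s \<eta>' > 0"
      unfolding eventually_at by blast
    \<comment> \<open>The reversed order persists near \<open>t\<close>. A rational time after
      \<open>t\<close> is nonnegative even for \<open>t = 0\<close>, and there the reversal
      contradicts strict monotonicity off \<open>N q\<close>.\<close>
    obtain q where q: "q \<in> \<rat>" "t < q" "q < t + d"
      using Rats_dense_in_real[of t "t + d"] d(1) by auto
    then have "X q \<eta> - X q \<eta>' > 0"
      using that(1) by (intro d(2)) (auto simp: dist_real_def)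
    moreover have "\<eta> \<in> {0..1} - N q" "\<eta>' \<in> {0..1} - N q"
      using that q by (auto simp: G_def)
    ultimately show False
      using strict_mono_onD[OF N(2)[of q], of \<eta> \<eta>'] that q by auto
  qed
  have "strict_mono_on G (X t)" if t: "t \<ge> 0" for t
  proof (rule strict_mono_onI)
    fix \<eta> \<eta>' assume *: "\<eta> \<in> G" "\<eta>' \<in> G" "\<eta> < \<eta>'"
    then have bnds: "0 \<le> \<eta>" "\<eta>' \<le> 1"
      by (auto simp: G_def)
    \<comment> \<open>Two labels of \<open>G\<close> that also avoid \<open>N t\<close> are placed
      between \<open>\<eta>\<close> and \<open>\<eta>'\<close>; the strict gap between them survives
      the weak inequalities on either side.\<close>
    have AE: "AE \<eta> in \<Omega>. \<eta> \<in> G \<and> \<eta> \<notin> N t"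
      using AE_G AE_not_in[OF N(1)[OF t]] by eventually_elim auto
    obtain p where p: "\<eta> < p" "p < \<eta>'" "p \<in> G \<and> p \<notin> N t"
      using AE_Omega_ex_in_interval[OF AE bnds(1) *(3) bnds(2)] .
    obtain p' where p': "p < p'" "p' < \<eta>'" "p' \<in> G \<and> p' \<notin> N t"
      using AE_Omega_ex_in_interval[OF AE _ p(2) bnds(2)] bnds p(1) by auto
    have "X t \<eta> \<le> X t p"
      using mono t * p by auto
    also have "X t p < X t p'"
      using p p' by (intro strict_mono_onD[OF N(2)[OF t]]) (auto simp: G_def)
    also have "X t p' \<le> X t \<eta>'"
      using mono t * p' by auto
    finally show "X t \<eta> < X t \<eta>'" .
  qed
  moreover have "G \<subseteq> {0..1}"
    by (auto simp: G_def)
  ultimately show thesis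
    using that[of G] AE_G by blast
qed

text \<open>The interaction force depends only on the order of the labels, so along a label of the
  common set \<open>G\<close> it is the constant \<open>chi_inf \<eta>\<close> at all positive
  times. Subtracting this constant from the position leaves a linear oscillator with rest point
  0.\<close>

lemma euler_lagrangian_decay:
  assumes "\<gamma> > 0" and a: "a = \<gamma> / (1 + \<gamma>\<^sup>2)"
    and sol: "euler_lagrangian_solution (\<lambda>x. \<bar>x\<bar>\<^sup>2 / 2) (\<lambda>x. - \<bar>x\<bar>) \<gamma> X v"
    and smooth: "smooth_solution X"
  shows "AE \<eta> in \<Omega>. \<forall>t\<ge>0. (X t \<eta> - chi_inf \<eta>)\<^sup>2 + (v t \<eta>)\<^sup>2
    \<le> 4 * exp (- (a / 4) * t) * ((X 0 \<eta> - chi_inf \<eta>)\<^sup>2 + (v 0 \<eta>)\<^sup>2)"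
proof -
  note sol' = sol[unfolded euler_lagrangian_solution_def pot_deriv_quadratic pot_deriv_neg_abs]
  have X: "X t \<in> borel_measurable \<Omega>" if "t \<ge> 0" for t
    using sol' that by blast
  have ode: "AE \<eta> in \<Omega>. continuous_on {0..} (\<lambda>t. X t \<eta>) \<and> continuous_on {0..} (\<lambda>t. v t \<eta>) \<and>
        (\<forall>t>0. ((\<lambda>s. X s \<eta>) has_real_derivative v t \<eta>) (at t) \<and>
               ((\<lambda>s. v s \<eta>) has_real_derivative
                  (- X t \<eta> - (LINT \<eta>'|\<Omega>. - sgn (X t \<eta> - X t \<eta>')) - \<gamma> * v t \<eta>)) (at t))"
    using sol' by blast
  have "AE \<eta> in \<Omega>. continuous_on {0..} (\<lambda>t. X t \<eta>)"
    using ode by eventually_elim blast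
  then obtain G where G: "G \<subseteq> {0..1}" "AE \<eta> in \<Omega>. \<eta> \<in> G"
      "\<And>t. t \<ge> 0 \<Longrightarrow> strict_mono_on G (X t)"
    using smooth_solution_uniform[OF smooth] by blast
  from ode G(2) show ?thesis
  proof eventually_elim
    case (elim \<eta>)
    show ?case
    proof (intro allI impI damped_oscillator_decay[OF assms(1) a])
      show "continuous_on {0..} (\<lambda>t. X t \<eta> - chi_inf \<eta>)" "continuous_on {0..} (\<lambda>t. v t \<eta>)"
        using elim by (auto intro!: continuous_intros)
      fix t :: real assume t: "t > 0"
      show "((\<lambda>t. X t \<eta> - chi_inf \<eta>) has_real_derivative v t \<eta>) (at t)"
        using elim t by (auto intro!: derivative_eq_intros)
      have "(LINT \<eta>'|\<Omega>. sgn (X t \<eta> - X t \<eta>')) = chi_inf \<eta>"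
        using LINT_sgn_strict_mono[OF X G(2) G(3)] t elim G(1) by auto
      then show "((\<lambda>t. v t \<eta>) has_real_derivative - (X t \<eta> - chi_inf \<eta>) - \<gamma> * v t \<eta>) (at t)"
        using elim t by (auto simp: algebra_simps)
    qed
  qed
qed

section \<open>From single labels to the norms over all labels\<close>

lemma L2_norm_le:
  assumes "(\<integral>\<^sup>+\<eta>. ennreal ((f \<eta>)\<^sup>2) \<partial>\<Omega>) \<le> ennreal (r\<^sup>2)" "r \<ge> 0"
  shows "L2_norm f \<le> ennreal r"
  using ennsqrt_mono[OF assms(1)] ennsqrt_ennreal_power2[OF assms(2)] by (simp add: L2_norm_def)

text \<open>The decay rate does not depend on the label, so the bound can be integrated. The rate
  \<open>a / 4\<close> of the squared quantities becomes \<open>a / 8\<close> for the norms.\<close>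

lemma L2_decay:
  assumes "\<gamma> > 0"
    and sol: "euler_lagrangian_solution (\<lambda>x. \<bar>x\<bar>\<^sup>2 / 2) (\<lambda>x. - \<bar>x\<bar>) \<gamma> X v"
    and smooth: "smooth_solution X"
    and fin: "L2_norm (\<lambda>\<eta>. X 0 \<eta> - chi_inf \<eta>) + L2_norm (v 0) < \<infinity>"
  shows "exponentially_fast (\<lambda>t. L2_norm (\<lambda>\<eta>. X t \<eta> - chi_inf \<eta>) + L2_norm (v t))"
proof -
  define a where "a = \<gamma> / (1 + \<gamma>\<^sup>2)"
  have "a > 0"
    using assms(1) by (simp add: a_def add_pos_nonneg)
  have meas: "X t \<in> borel_measurable \<Omega>" "v t \<in> borel_measurable \<Omega>" if "t \<ge> 0" for t
    using sol that unfolding euler_lagrangian_solution_def by blast+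
  have [measurable]: "X 0 \<in> borel_measurable \<Omega>" "v 0 \<in> borel_measurable \<Omega>" "chi_inf \<in> borel_measurable \<Omega>"
    using meas chi_inf_measurable borel_measurable_Omega by auto
  define e where "e t \<eta> = (X t \<eta> - chi_inf \<eta>)\<^sup>2 + (v t \<eta>)\<^sup>2" for t \<eta>
  define I where "I = (\<integral>\<^sup>+\<eta>. ennreal (e 0 \<eta>) \<partial>\<Omega>)"
  have "I = (\<integral>\<^sup>+\<eta>. ennreal ((X 0 \<eta> - chi_inf \<eta>)\<^sup>2) \<partial>\<Omega>) + (\<integral>\<^sup>+\<eta>. ennreal ((v 0 \<eta>)\<^sup>2) \<partial>\<Omega>)"
    unfolding I_def e_def by (subst nn_integral_add[symmetric]) auto
  then have "I < \<infinity>"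
    using fin by (auto simp: L2_norm_def ennsqrt_less_top_iff)
  \<comment> \<open>The initial total is written as a square so that the later bounds are squares
    too and their roots are explicit.\<close>
  then obtain K where K: "K \<ge> 0" "I = ennreal (K\<^sup>2)"
    by (cases I) (auto intro: that[of "sqrt _"])
  have e_le: "(\<integral>\<^sup>+\<eta>. ennreal (e t \<eta>) \<partial>\<Omega>) \<le> ennreal ((2 * exp (- (a / 8) * t) * K)\<^sup>2)" if "t \<ge> 0" for t
  proof -
    have "AE \<eta> in \<Omega>. ennreal (e t \<eta>) \<le> ennreal (4 * exp (- (a / 4) * t)) * ennreal (e 0 \<eta>)"
      using euler_lagrangian_decay[OF assms(1) a_def sol smooth]
    proof eventually_elim
      case (elim \<eta>)
      then have "e t \<eta> \<le> 4 * exp (- (a / 4) * t) * e 0 \<eta>"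
        using that by (simp add: e_def)
      then show ?case
        by (simp only: ennreal_leI flip: ennreal_mult'[OF mult_nonneg_nonneg[OF zero_le_numeral exp_ge_zero]])
    qed
    then have "(\<integral>\<^sup>+\<eta>. ennreal (e t \<eta>) \<partial>\<Omega>)
        \<le> (\<integral>\<^sup>+\<eta>. ennreal (4 * exp (- (a / 4) * t)) * ennreal (e 0 \<eta>) \<partial>\<Omega>)"
      by (rule nn_integral_mono_AE)
    also have "\<dots> = ennreal (4 * exp (- (a / 4) * t)) * I"
      unfolding I_def e_def by (rule nn_integral_cmult) measurable
    also have "\<dots> = ennreal (4 * exp (- (a / 4) * t) * K\<^sup>2)"
      by (simp add: K ennreal_mult'[symmetric])
    also have "4 * exp (- (a / 4) * t) * K\<^sup>2 = (2 * exp (- (a / 8) * t) * K)\<^sup>2"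
      by (simp add: power_mult_distrib exp_double[symmetric])
    finally show ?thesis .
  qed
  \<comment> \<open>Each norm is at most \<open>2 * K * exp (- (a / 8) * t)\<close>. The added 1
    makes the constant positive when \<open>K = 0\<close>, as \<open>exponentially_fast\<close>
    demands.\<close>
  have "L2_norm (\<lambda>\<eta>. X t \<eta> - chi_inf \<eta>) + L2_norm (v t) \<le> ennreal ((4 * K + 1) * exp (- (a / 8) * t))"
    if "t \<ge> 0" for t
  proof -
    let ?r = "2 * exp (- (a / 8) * t) * K"
    have "L2_norm (\<lambda>\<eta>. X t \<eta> - chi_inf \<eta>) \<le> ennreal ?r"
      by (rule L2_norm_le[OF order_trans[OF nn_integral_mono e_le[OF that]]])
         (auto simp: e_def K simp del: ennreal_plus intro!: ennreal_leI)
    moreover have "L2_norm (v t) \<le> ennreal ?r"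
      by (rule L2_norm_le[OF order_trans[OF nn_integral_mono e_le[OF that]]])
         (auto simp: e_def K simp del: ennreal_plus intro!: ennreal_leI)
    ultimately have "L2_norm (\<lambda>\<eta>. X t \<eta> - chi_inf \<eta>) + L2_norm (v t) \<le> ennreal ?r + ennreal ?r"
      by (rule add_mono)
    also have "\<dots> = ennreal (?r + ?r)"
      using K(1) by (intro ennreal_plus[symmetric]) auto
    also have "\<dots> \<le> ennreal ((4 * K + 1) * exp (- (a / 8) * t))"
      by (intro ennreal_leI) (simp add: algebra_simps)
    finally show ?thesis .
  qed
  then show ?thesis
    unfolding exponentially_fast_def using K(1) \<open>a > 0\<close>
    by (intro exI[of _ "4 * K + 1"] exI[of _ "a / 8"]) auto
qed

subsection \<open>Push-forward measures\<close>

text \<open>Since \<open>chi_inf\<close> is bounded by 1 on the reference space of mass 1, a map at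
  finite distance from it is itself square integrable.\<close>

lemma push_in_P2:
  assumes f: "f \<in> borel_measurable \<Omega>" and fin: "L2_norm (\<lambda>\<eta>. f \<eta> - chi_inf \<eta>) < \<infinity>"
  shows "push f \<in> P2"
proof -
  interpret prob_space \<Omega>
    by (rule prob_space_Omega)
  have [measurable]: "f \<in> borel_measurable \<Omega>" "chi_inf \<in> borel_measurable \<Omega>"
    using f chi_inf_measurable borel_measurable_Omega by auto
  have "(\<integral>\<^sup>+x. ennreal (x\<^sup>2) \<partial>push f) = (\<integral>\<^sup>+\<eta>. ennreal ((f \<eta>)\<^sup>2) \<partial>\<Omega>)"
    unfolding push_def by (rule nn_integral_distr) auto
  also have "\<dots> \<le> (\<integral>\<^sup>+\<eta>. 2 * ennreal ((f \<eta> - chi_inf \<eta>)\<^sup>2) + 2 \<partial>\<Omega>)"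
  proof (rule nn_integral_mono)
    fix \<eta> assume "\<eta> \<in> space \<Omega>"
    then have "\<bar>chi_inf \<eta>\<bar> \<le> 1"
      by (auto simp: chi_inf_def abs_le_iff)
    then have "(chi_inf \<eta>)\<^sup>2 \<le> 1"
      by (simp add: abs_square_le_1)
    \<comment> \<open>With \<open>c = chi_inf \<eta>\<close>, this square is exactly the difference
      between \<open>2 * (f \<eta> - c)\<^sup>2 + 2 * c\<^sup>2\<close> and
      \<open>(f \<eta>)\<^sup>2\<close>.\<close>
    moreover have "0 \<le> (f \<eta> - 2 * chi_inf \<eta>)\<^sup>2"
      by simp
    ultimately have "(f \<eta>)\<^sup>2 \<le> 2 * (f \<eta> - chi_inf \<eta>)\<^sup>2 + 2"
      unfolding power2_eq_square by (simp add: algebra_simps)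
    then have "ennreal ((f \<eta>)\<^sup>2) \<le> ennreal (2 * (f \<eta> - chi_inf \<eta>)\<^sup>2 + 2)"
      by (rule ennreal_leI)
    also have "\<dots> = 2 * ennreal ((f \<eta> - chi_inf \<eta>)\<^sup>2) + 2"
      by (simp add: ennreal_mult)
    finally show "ennreal ((f \<eta>)\<^sup>2) \<le> 2 * ennreal ((f \<eta> - chi_inf \<eta>)\<^sup>2) + 2" .
  qed
  also have "\<dots> = 2 * (\<integral>\<^sup>+\<eta>. ennreal ((f \<eta> - chi_inf \<eta>)\<^sup>2) \<partial>\<Omega>) + 2"
    using emeasure_space_1 by (simp add: nn_integral_add nn_integral_cmult del: space_restrict_space)
  also have "\<dots> < \<infinity>"
    using fin by (auto simp: L2_norm_def ennsqrt_less_top_iff ennreal_mult_less_top)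
  finally show ?thesis
    using prob_space_distr[OF f] by (simp add: P2_def push_def)
qed

text \<open>The joint law of \<open>f\<close> and \<open>g\<close> is an admissible coupling whose
  cost is the squared distance of the maps; the infimum can only be smaller.\<close>

lemma W2_push_le_L2_norm:
  assumes f: "f \<in> borel_measurable \<Omega>" and g: "g \<in> borel_measurable \<Omega>"
  shows "W2 (push f) (push g) \<le> L2_norm (\<lambda>\<eta>. f \<eta> - g \<eta>)"
proof -
  note [measurable] = f g
  define \<pi> where "\<pi> = distr \<Omega> (borel \<Otimes>\<^sub>M borel) (\<lambda>\<eta>. (f \<eta>, g \<eta>))"
  have "distr \<pi> borel fst = push f" "distr \<pi> borel snd = push g"
    unfolding \<pi>_def push_def by (subst distr_distr; simp add: comp_def)+
  then have "\<pi> \<in> couplings (push f) (push g)"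
    by (simp add: couplings_def \<pi>_def)
  moreover have "(\<integral>\<^sup>+(x, y). ennreal ((x - y)\<^sup>2) \<partial>\<pi>) = (\<integral>\<^sup>+\<eta>. ennreal ((f \<eta> - g \<eta>)\<^sup>2) \<partial>\<Omega>)"
    unfolding \<pi>_def by (subst nn_integral_distr) auto
  ultimately show ?thesis
    unfolding W2_def L2_norm_def by (auto intro!: ennsqrt_mono INF_lower2)
qed

text \<open>This is the affine change of variables \<open>x = 2 * \<eta> - 1\<close>, whose inverse
  has the derivative 1/2.\<close>

lemma push_chi_inf: "push chi_inf = density lborel (\<lambda>x. ennreal (1 / 2 * indicator {-1<..<1} x))"
proof (rule measure_eqI)
  fix A assume "A \<in> sets (push chi_inf)"
  then have A[measurable]: "A \<in> sets borel"
    by (simp add: push_def)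
  have [measurable]: "chi_inf \<in> borel_measurable \<Omega>" "chi_inf \<in> borel_measurable borel"
    using chi_inf_measurable borel_measurable_Omega by auto
  have B: "{x\<in>{0..1}. chi_inf x \<in> A} \<in> sets borel"
    by measurable
  have half: "ennreal (1 / 2) * ennreal 2 = 1"
    by (subst ennreal_mult''[symmetric]) auto
  have "emeasure (push chi_inf) A = emeasure \<Omega> {x\<in>{0..1}. chi_inf x \<in> A}"
    unfolding push_def by (subst emeasure_distr) (auto intro!: arg_cong[of _ _ "emeasure \<Omega>"])
  also have "\<dots> = emeasure lborel {x\<in>{0..1}. chi_inf x \<in> A}"
    using B by (subst emeasure_restrict_space) auto
  also have "\<dots> = (\<integral>\<^sup>+x. indicator {0..1} x * indicator A (chi_inf x) \<partial>lborel)"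
    using B by (subst nn_integral_indicator[of "{x\<in>{0..1}. chi_inf x \<in> A}", symmetric])
      (simp, intro nn_integral_cong, auto split: split_indicator)
  \<comment> \<open>The label is recovered from its image \<open>x\<close> as
    \<open>(1 + x) / 2\<close>.\<close>
  also have "\<dots> = (\<integral>\<^sup>+x. indicator {0..1} ((1 + x) / 2) * indicator A x
      \<partial>distr lborel borel (\<lambda>x. - 1 + 2 * x))"
    by (subst nn_integral_distr) (auto simp: chi_inf_def)
  \<comment> \<open>The inserted 2 is the density of Lebesgue measure with respect to its image
    under the affine map, so the next step can absorb it.\<close>
  also have "\<dots> = (\<integral>\<^sup>+x. ennreal (1 / 2) * (ennreal 2 * (indicator {0..1} ((1 + x) / 2) * indicator A x))
      \<partial>distr lborel borel (\<lambda>x. - 1 + 2 * x))"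
    by (simp only: mult.assoc[symmetric] half mult_1)
  also have "\<dots> = (\<integral>\<^sup>+x. ennreal (1 / 2) * (indicator {0..1} ((1 + x) / 2) * indicator A x) \<partial>lborel)"
    by (subst (2) lborel_real_affine[of 2 "-1"], simp, subst nn_integral_density)
       (auto simp: ac_simps)
  also have "\<dots> = (\<integral>\<^sup>+x. ennreal (1 / 2 * indicator {-1<..<1} x) * indicator A x \<partial>lborel)"
  \<comment> \<open>The left side lives on the closed interval, the right side on the open one; they
    differ only at -1 and 1.\<close>
  proof (rule nn_integral_cong_AE)
    show "AE x in lborel. ennreal (1 / 2) * (indicator {0..1} ((1 + x) / 2) * indicator A x)
        = ennreal (1 / 2 * indicator {-1<..<1} x) * indicator A x"
      using AE_lborel_singleton[of "-1::real"] AE_lborel_singleton[of "1::real"]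
      by eventually_elim (auto simp: indicator_def)
  qed
  also have "\<dots> = emeasure (density lborel (\<lambda>x. ennreal (1 / 2 * indicator {-1<..<1} x))) A"
    by (subst emeasure_density) auto
  finally show "emeasure (push chi_inf) A
    = emeasure (density lborel (\<lambda>x. ennreal (1 / 2 * indicator {-1<..<1} x))) A" .
qed (simp add: push_def)

theorem theorem6:
  fixes \<gamma> :: real and X v :: "real \<Rightarrow> real \<Rightarrow> real"
  assumes "\<gamma> > 0"
    and "euler_lagrangian_solution (\<lambda>x. \<bar>x\<bar>\<^sup>2 / 2) (\<lambda>x. - \<bar>x\<bar>) \<gamma> X v"
    and "smooth_solution X"
    and "L2_norm (\<lambda>\<eta>. X 0 \<eta> - chi_inf \<eta>) + L2_norm (v 0) < \<infinity>"
  shows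
    "((\<lambda>t. L2_norm (\<lambda>\<eta>. X t \<eta> - chi_inf \<eta>) + L2_norm (v t)) \<longlongrightarrow> 0) at_top \<and>
     exponentially_fast (\<lambda>t. L2_norm (\<lambda>\<eta>. X t \<eta> - chi_inf \<eta>) + L2_norm (v t)) \<and>
     (\<forall>t\<ge>0. push (X t) \<in> P2) \<and>
     push chi_inf \<in> P2 \<and>
     push chi_inf = density lborel (\<lambda>x. ennreal (1 / 2 * indicator {-1<..<1} x)) \<and>
     ((\<lambda>t. W2 (push (X t)) (push chi_inf)) \<longlongrightarrow> 0) at_top \<and>
     exponentially_fast (\<lambda>t. W2 (push (X t)) (push chi_inf))"
proof -
  have X: "X t \<in> borel_measurable \<Omega>" if "t \<ge> 0" for t
    using assms(2) that unfolding euler_lagrangian_solution_def by blast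
  have chi: "chi_inf \<in> borel_measurable \<Omega>"
    using chi_inf_measurable by (rule borel_measurable_Omega)
  have decay: "exponentially_fast (\<lambda>t. L2_norm (\<lambda>\<eta>. X t \<eta> - chi_inf \<eta>) + L2_norm (v t))"
    using L2_decay[OF assms] .
  \<comment> \<open>Finiteness is assumed at time 0 only; the exponential bound carries it to every
    later time.\<close>
  have "L2_norm (\<lambda>\<eta>. X t \<eta> - chi_inf \<eta>) < \<infinity>" if "t \<ge> 0" for t
  proof -
    obtain C where "L2_norm (\<lambda>\<eta>. X t \<eta> - chi_inf \<eta>) + L2_norm (v t) \<le> ennreal C"
      using decay \<open>t \<ge> 0\<close> unfolding exponentially_fast_def by blast
    then show ?thesis
      by (metis ennreal_less_top ennreal_add_less_top infinity_ennreal_def order_le_less_trans)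
  qed
  then have "\<forall>t\<ge>0. push (X t) \<in> P2"
    using push_in_P2 X by blast
  moreover have "push chi_inf \<in> P2"
    \<comment> \<open>Here the difference from \<open>chi_inf\<close> vanishes identically.\<close>
    by (rule push_in_P2[OF chi]) (simp add: L2_norm_def ennsqrt_def)
  moreover have W: "exponentially_fast (\<lambda>t. W2 (push (X t)) (push chi_inf))"
  proof (rule exponentially_fast_mono[OF decay])
    fix t :: real assume "t \<ge> 0"
    show "W2 (push (X t)) (push chi_inf) \<le> L2_norm (\<lambda>\<eta>. X t \<eta> - chi_inf \<eta>) + L2_norm (v t)"
      using W2_push_le_L2_norm[OF X[OF \<open>t \<ge> 0\<close>] chi] by (rule add_increasing2[rotated]) simp
  qed
  ultimately show ?thesis
    using decay push_chi_inf exponentially_fast_imp_tendsto_0 by blast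
qed

end
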